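(* Let $n,T\in\mathbb{N}$, let $z\in\mathbb{R}^n$ with $z_i\ge 0$ for all $i\in[n]$ and $\beta:=\max_{i\in[n]}z_i<1$, and let $c^1,\dots,c^T\in\mathbb{R}^n$ and $r^1,\dots,r^T\in[0,\infty)^n$ be arbitrary fixed sequences of cost and reward vectors. Let $X^1,\dots,X^T\subseteq[n]$ be the random sets selected by the algorithm MaxHedge (defined in the context) on trials $1,\dots,T$. Then for every set $S\subseteq[n]$ with $\sum_{i\in S}z_i\le 1$, $$\mathbb{E}\Big(\sum_{t=1}^T\mu^t(X^t)\Big)\;\ge\;\sum_{t=1}^T\hat\mu^t_{\alpha,\delta}(S)\;-\;n\sqrt{2T}\,\delta(\hat r+\hat c),$$ where $\delta:=(1-\sqrt{\beta})^2$, $\alpha:=1-\exp\left(-(1-\sqrt\beta)^2\right)$, $\hat r:=\max_{t\in[T],i\in[n]}r^t_i$ and $\hat c:=\max_{t\in[T],i\in[n]}|c^t_i|$.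
   Context: $[l]:=\{1,\dots,l\}$; $\mathbb N$ is the set of positive integers; $\langle\cdot,\cdot\rangle$ and $\|\cdot\|$ are the Euclidean inner product and norm. $c^{t+}_i:=\max\{0,c^t_i\}$, $c^{t-}_i:=\min\{0,c^t_i\}$. Profit: for $X\subseteq[n]$, $\mu^t(X):=\max_{i\in X}r^t_i-\sum_{i\in X}c^t_i$, where a maximum over the empty set is defined to be $0$. Discounted profit: $\hat\mu^t_{\alpha,\delta}(S):=\alpha\max_{i\in S}r^t_i-\alpha\sum_{i\in S}c^{t-}_i-\delta\sum_{i\in S}c^{t+}_i$. MaxHedge. Let $C:=\{x\in[0,1]^n:\langle x,z\rangle\le1\}$, let $\Pi_C$ be the Euclidean projection onto $C$, $\tau:=1-\sqrt\beta$, $\delta:=(1-\sqrt\beta)^2$. MaxHedge maintains $\omega^t\in C$, with $\omega^1:=0$, and $\hat\eta^0:=\infty$. Selection (Algorithm 1): for $q\in\mathbb{N}$ let $\Omega_q:=\{i\in[n]:\tau^q\beta<z_i\le\tau^{q-1}\beta\}$ and $\Gamma:=\{q\in\mathbb N:\Omega_q\ne\emptyset\}$. On trial $t$, for $q\in\Gamma$ set $\pi^t_q:=\sum_{i\in\Omega_q}\omega^t_i$ and $\zeta^t_q:=\lfloor\delta\pi^t_q\rfloor$. Draw mutually independent random variables $\xi^t_{q,k}$ ($q\in\Gamma$, $1\le k\le\zeta^t_q+1$): for $k\le\zeta^t_q$, $\xi^t_{q,k}=i$ with probability $\omega^t_i/\pi^t_q$ for each $i\in\Omega_q$; for $k=\zeta^t_q+1$,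 $\xi^t_{q,k}=i$ with probability $(\delta\pi^t_q-\lfloor\delta\pi^t_q\rfloor)\omega^t_i/\pi^t_q$ for each $i\in\Omega_q$ (with $0/0:=0$), and $\xi^t_{q,k}=0$ with probability $\lfloor\delta\pi^t_q\rfloor+1-\delta\pi^t_q$. Set $X^t:=\{\xi^t_{q,k}:q\in\Gamma,\,k\le\zeta^t_q+1\}\setminus\{0\}$. Update (Algorithm 2): after $c^t,r^t$ are revealed, let $\sigma(t,1),\dots,\sigma(t,n)$ be an ordering of $[n]$ with $r^t_{\sigma(t,j)}\ge r^t_{\sigma(t,j+1)}$ for $j\in[n-1]$. For $j\in[n]$ set $\epsilon^t_j:=\exp\left(-\delta\sum_{k=1}^j\omega^t_{\sigma(t,k)}\right)$, $\lambda^t_j:=r^t_{\sigma(t,n)}\epsilon^t_n+\sum_{k=j}^{n-1}\left(r^t_{\sigma(t,k)}-r^t_{\sigma(t,k+1)}\right)\epsilon^t_k$, $g^t_{\sigma(t,j)}:=\delta\left(c^{t+}_{\sigma(t,j)}+c^{t-}_{\sigma(t,j)}\exp(-\delta\omega^t_{\sigma(t,j)})-\lambda^t_j\right)$. Then $\hat\eta^t:=\min\{\hat\eta^{t-1},\sqrt n/\|g^t\|\}$, $\eta^t:=\hat\eta^t/\sqrt{2t}$, and $\omega^{t+1}:=\Pi_C(\omega^t-\eta^tg^t)$. Conventions: $\sqrt n/0:=\infty$, and if $g^t=0$ then $\eta^tg^t:=0$, so $\omega^{t+1}=\omega^t$.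
   Formalization: The sizes are assumed strictly positive (z_i > 0 instead of z_i ≥ 0): an item of size 0 lies in no class Ω_q and is never selected, so the claim as written fails, e.g. for n=1, z=0, r^t=1, c^t=0, S={1}, T=6. *)

theory Defs
  imports "HOL-Probability.Probability"
begin

text \<open>
  Items are the elements of a finite type, so that vectors of rewards, costs, sizes and weights are
  elements of Euclidean space and the number of items is the cardinality of that type. Trials, size
  classes, draws and ranks are numbered from 1.
\<close>

definition max_reward :: "real ^ 'n \<Rightarrow> 'n set \<Rightarrow> real" where
  "max_reward r X = (if X = {} then 0 else Max ((\<lambda>i. r $ i) ` X))"

definition profit :: "real ^ 'n \<Rightarrow> real ^ 'n \<Rightarrow> 'n set \<Rightarrow> real" where
  "profit r c X = max_reward r X - (\<Sum>i\<in>X. c $ i)"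

definition discounted_profit ::
    "real \<Rightarrow> real \<Rightarrow> real ^ 'n \<Rightarrow> real ^ 'n \<Rightarrow> 'n set \<Rightarrow> real" where
  "discounted_profit \<alpha> \<delta> r c S =
     \<alpha> * max_reward r S - \<alpha> * (\<Sum>i\<in>S. min 0 (c $ i)) - \<delta> * (\<Sum>i\<in>S. max 0 (c $ i))"

definition max_size :: "real ^ 'n \<Rightarrow> real" where
  "max_size z = Max (range (\<lambda>i. z $ i))"

definition mh_tau :: "real ^ 'n \<Rightarrow> real" where
  "mh_tau z = 1 - sqrt (max_size z)"

definition mh_delta :: "real ^ 'n \<Rightarrow> real" where
  "mh_delta z = (1 - sqrt (max_size z))\<^sup>2"

definition mh_alpha :: "real ^ 'n \<Rightarrow> real" where
  "mh_alpha z = 1 - exp (- ((1 - sqrt (max_size z))\<^sup>2))"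

definition weight_polytope :: "real ^ 'n \<Rightarrow> (real ^ 'n) set" where
  "weight_polytope z = {x. (\<forall>i. 0 \<le> x $ i \<and> x $ i \<le> 1) \<and> x \<bullet> z \<le> 1}"


section \<open>The update\<close>

definition reward_ordering :: "real ^ 'n \<Rightarrow> (nat \<Rightarrow> 'n) \<Rightarrow> bool" where
  "reward_ordering r \<sigma> \<longleftrightarrow>
     bij_betw \<sigma> {1..CARD('n)} UNIV \<and> (\<forall>j\<in>{1..<CARD('n)}. r $ \<sigma> j \<ge> r $ \<sigma> (j + 1))"

definition mh_epsilon :: "real \<Rightarrow> (nat \<Rightarrow> 'n) \<Rightarrow> real ^ 'n \<Rightarrow> nat \<Rightarrow> real" where
  "mh_epsilon \<delta> \<sigma> \<omega> j = exp (- \<delta> * (\<Sum>k=1..j. \<omega> $ \<sigma> k))"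

definition mh_lambda :: "real \<Rightarrow> real ^ 'n \<Rightarrow> (nat \<Rightarrow> 'n) \<Rightarrow> real ^ 'n \<Rightarrow> nat \<Rightarrow> real" where
  "mh_lambda \<delta> r \<sigma> \<omega> j =
     r $ \<sigma> CARD('n) * mh_epsilon \<delta> \<sigma> \<omega> CARD('n)
     + (\<Sum>k=j..<CARD('n). (r $ \<sigma> k - r $ \<sigma> (k + 1)) * mh_epsilon \<delta> \<sigma> \<omega> k)"

text \<open>The component at item \<open>i\<close> uses the rank of \<open>i\<close>, that is, the unique \<open>j\<close> with \<open>\<sigma> j = i\<close>.\<close>

definition mh_gradient ::
    "real \<Rightarrow> real ^ 'n \<Rightarrow> real ^ 'n \<Rightarrow> (nat \<Rightarrow> 'n) \<Rightarrow> real ^ 'n \<Rightarrow> real ^ 'n" where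
  "mh_gradient \<delta> r c \<sigma> \<omega> =
     (\<chi> i. \<delta> * (max 0 (c $ i) + min 0 (c $ i) * exp (- \<delta> * \<omega> $ i)
                 - mh_lambda \<delta> r \<sigma> \<omega> (the_inv_into {1..CARD('n)} \<sigma> i)))"

text \<open>
  \<open>mh_state z r c \<sigma> t\<close> is the pair of the weight vector for trial \<open>t + 1\<close> and the value of the
  scale-free learning rate after trial \<open>t\<close>. The latter is an extended real, for which division of a
  positive number by \<open>0\<close> is \<open>\<infinity>\<close>. It is finite as soon as some gradient is nonzero; the
  conversion back to a real is therefore only applied to \<open>\<infinity>\<close> when the current gradient is zero, and
  then the step is zero as required.
\<close>

primrec mh_state ::
    "real ^ 'n \<Rightarrow> (nat \<Rightarrow> real ^ 'n) \<Rightarrow> (nat \<Rightarrow> real ^ 'n) \<Rightarrow> (nat \<Rightarrow> nat \<Rightarrow> 'n) \<Rightarrow> nat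
      \<Rightarrow> (real ^ 'n) \<times> ereal" where
  "mh_state z r c \<sigma> 0 = (0, \<infinity>)"
| "mh_state z r c \<sigma> (Suc t) =
     (let \<omega> = fst (mh_state z r c \<sigma> t);
          g = mh_gradient (mh_delta z) (r (Suc t)) (c (Suc t)) (\<sigma> (Suc t)) \<omega>;
          \<eta>hat = min (snd (mh_state z r c \<sigma> t)) (ereal (sqrt (real CARD('n))) / ereal (norm g));
          \<eta> = \<eta>hat / ereal (sqrt (2 * real (Suc t)))
      in (closest_point (weight_polytope z) (\<omega> - real_of_ereal \<eta> *\<^sub>R g), \<eta>hat))"

definition mh_weights ::
    "real ^ 'n \<Rightarrow> (nat \<Rightarrow> real ^ 'n) \<Rightarrow> (nat \<Rightarrow> real ^ 'n) \<Rightarrow> (nat \<Rightarrow> nat \<Rightarrow> 'n) \<Rightarrow> nat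
      \<Rightarrow> real ^ 'n" where
  "mh_weights z r c \<sigma> t = fst (mh_state z r c \<sigma> (t - 1))"


section \<open>The selection\<close>

text \<open>An item of size 0 would lie in no class, and hence could never be selected.\<close>

definition mh_Omega :: "real ^ 'n \<Rightarrow> nat \<Rightarrow> 'n set" where
  "mh_Omega z q =
     {i. mh_tau z ^ q * max_size z < z $ i \<and> z $ i \<le> mh_tau z ^ (q - 1) * max_size z}"

definition mh_Gamma :: "real ^ 'n \<Rightarrow> nat set" where
  "mh_Gamma z = {q. 1 \<le> q \<and> mh_Omega z q \<noteq> {}}"

definition class_weight :: "real ^ 'n \<Rightarrow> real ^ 'n \<Rightarrow> nat \<Rightarrow> real" where
  "class_weight z \<omega> q = (\<Sum>i\<in>mh_Omega z q. \<omega> $ i)"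

definition full_draws :: "real ^ 'n \<Rightarrow> real ^ 'n \<Rightarrow> nat \<Rightarrow> nat" where
  "full_draws z \<omega> q = nat \<lfloor>mh_delta z * class_weight z \<omega> q\<rfloor>"

definition draw_indices :: "real ^ 'n \<Rightarrow> real ^ 'n \<Rightarrow> (nat \<times> nat) set" where
  "draw_indices z \<omega> = {(q, k). q \<in> mh_Gamma z \<and> 1 \<le> k \<and> k \<le> full_draws z \<omega> q + 1}"

text \<open>\<open>None\<close> is the outcome 0, in which no item is drawn.\<close>

fun draw_probability ::
    "real ^ 'n \<Rightarrow> real ^ 'n \<Rightarrow> nat \<Rightarrow> nat \<Rightarrow> 'n option \<Rightarrow> real" where
  "draw_probability z \<omega> q k (Some i) =
     (if i \<notin> mh_Omega z q then 0
      else if k \<le> full_draws z \<omega> q then \<omega> $ i / class_weight z \<omega> q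
      else frac (mh_delta z * class_weight z \<omega> q) * \<omega> $ i / class_weight z \<omega> q)"
| "draw_probability z \<omega> q k None =
     (if k \<le> full_draws z \<omega> q then 0 else 1 - frac (mh_delta z * class_weight z \<omega> q))"

definition selection_draws ::
    "real ^ 'n \<Rightarrow> real ^ 'n \<Rightarrow> 'a measure \<Rightarrow> (nat \<Rightarrow> nat \<Rightarrow> 'a \<Rightarrow> 'n option) \<Rightarrow> bool" where
  "selection_draws z \<omega> M \<xi> \<longleftrightarrow>
     prob_space.indep_vars M (\<lambda>_. count_space UNIV) (\<lambda>(q, k). \<xi> q k) (draw_indices z \<omega>) \<and>
     (\<forall>(q, k)\<in>draw_indices z \<omega>. \<forall>v.
        measure M {x \<in> space M. \<xi> q k x = v} = draw_probability z \<omega> q k v)"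

definition selected_set ::
    "real ^ 'n \<Rightarrow> real ^ 'n \<Rightarrow> (nat \<Rightarrow> nat \<Rightarrow> 'a \<Rightarrow> 'n option) \<Rightarrow> 'a \<Rightarrow> 'n set" where
  "selected_set z \<omega> \<xi> x = {i. \<exists>(q, k)\<in>draw_indices z \<omega>. \<xi> q k x = Some i}"

end

theory Submission
  imports Defs
begin

text \<open>
  Write the maximal reward of a set as a nonnegative combination of the indicators "the set meets the
  \<open>k\<close> best items". The draws are independent and the probabilities with which they hit
  an item \<open>i\<close> add up to \<open>\<delta> \<omega> i\<close>. Hence a set \<open>Y\<close> is missed with
  probability at most \<open>exp (- \<delta> (\<Sum>i\<in>Y. \<omega> i))\<close>, and met with probability at most
  \<open>\<delta> (\<Sum>i\<in>Y. \<omega> i)\<close>. So the expected profit of a trial is at least a concave function of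
  \<open>\<omega>\<close>, whose gradient is minus the vector \<open>g\<close> of the update and whose value at the
  indicator vector of \<open>S\<close> is at least the discounted profit of \<open>S\<close>. Concavity bounds the loss
  against \<open>S\<close> by the linear regret of projected gradient descent on the weight polytope, whose
  squared diameter is at most \<open>n\<close>, with gradients of norm at most
  \<open>sqrt n * \<delta> * (rhat + chat)\<close>.
\<close>

section \<open>Layers of the reward\<close>

text \<open>The drops between consecutive ranked rewards, with reward 0 imagined after the last
  rank; hence the separate case. They are the coefficients of a layer-cake decomposition.\<close>

definition reward_gap :: "real ^ 'n \<Rightarrow> (nat \<Rightarrow> 'n) \<Rightarrow> nat \<Rightarrow> real" where
  "reward_gap r \<sigma> k = (if k = CARD('n) then r $ \<sigma> k else r $ \<sigma> k - r $ \<sigma> (k + 1))"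

lemma reward_gap_nonneg:
  fixes r :: "real ^ 'n"
  assumes "reward_ordering r \<sigma>" "\<And>i. r $ i \<ge> 0" "k \<in> {1..CARD('n)}"
  shows "reward_gap r \<sigma> k \<ge> 0"
  using assms by (auto simp: reward_gap_def reward_ordering_def)

lemma sum_reward_gap:
  fixes r :: "real ^ 'n"
  assumes "1 \<le> j" "j \<le> CARD('n)"
  shows "(\<Sum>k=j..CARD('n). reward_gap r \<sigma> k) = r $ \<sigma> j"
  using assms(2,1)
proof (induction j rule: inc_induct)
  case base
  then show ?case by (simp add: reward_gap_def)
next
  case (step m)
  have "{m..CARD('n)} = insert m {Suc m..CARD('n)}" using step by auto
  then show ?case using step by (simp add: reward_gap_def)
qed

lemma mh_lambda_eq_sum_gap:
  fixes r :: "real ^ 'n"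
  assumes "j \<le> CARD('n)"
  shows "mh_lambda \<delta> r \<sigma> \<omega> j = (\<Sum>k=j..CARD('n). reward_gap r \<sigma> k * mh_epsilon \<delta> \<sigma> \<omega> k)"
proof -
  have "{j..CARD('n)} = insert CARD('n) {j..<CARD('n)}" using assms by auto
  then show ?thesis
    by (simp add: mh_lambda_def reward_gap_def)
qed

lemma reward_ordering_antimono:
  fixes r :: "real ^ 'n"
  assumes "reward_ordering r \<sigma>" "\<And>i. r $ i \<ge> 0" "1 \<le> j" "j \<le> k" "k \<le> CARD('n)"
  shows "r $ \<sigma> k \<le> r $ \<sigma> j"
proof -
  have "r $ \<sigma> k = (\<Sum>l=k..CARD('n). reward_gap r \<sigma> l)"
    using assms by (simp add: sum_reward_gap)
  also have "\<dots> \<le> (\<Sum>l=j..CARD('n). reward_gap r \<sigma> l)"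
    using assms by (intro sum_mono2) (auto intro!: reward_gap_nonneg)
  also have "\<dots> = r $ \<sigma> j"
    using assms by (simp add: sum_reward_gap)
  finally show ?thesis .
qed

text \<open>If \<open>m\<close> is the best rank occurring in \<open>X\<close>, then
  \<open>X\<close> meets the first \<open>k\<close> ranks exactly when \<open>m \<le> k\<close>.
  What remains is the tail of the gaps from \<open>m\<close> on, which telescopes to the best
  reward.\<close>

lemma max_reward_layers:
  fixes r :: "real ^ 'n"
  assumes ord: "reward_ordering r \<sigma>" and nonneg: "\<And>i. r $ i \<ge> 0"
  shows "max_reward r X =
    (\<Sum>k=1..CARD('n). reward_gap r \<sigma> k * of_bool (X \<inter> \<sigma> ` {1..k} \<noteq> {}))"
proof (cases "X = {}")
  case True
  then show ?thesis by (simp add: max_reward_def)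
next
  case False
  define P where "P j \<longleftrightarrow> 1 \<le> j \<and> j \<le> CARD('n) \<and> \<sigma> j \<in> X" for j
  have img: "\<sigma> ` {1..CARD('n)} = UNIV"
    using ord by (auto simp: reward_ordering_def bij_betw_def)
  obtain i where "i \<in> X" using False by blast
  moreover have "i \<in> \<sigma> ` {1..CARD('n)}" using img by simp
  ultimately have "\<exists>j. P j" by (auto simp: P_def)
  define m where "m = (LEAST j. P j)"
  have m: "P m" unfolding m_def using \<open>\<exists>j. P j\<close> by (rule LeastI_ex)
  have least: "m \<le> j" if "P j" for j unfolding m_def using that by (rule Least_le)
  have meets: "X \<inter> \<sigma> ` {1..k} \<noteq> {} \<longleftrightarrow> m \<le> k" if "k \<in> {1..CARD('n)}" for k
  proof
    assume "X \<inter> \<sigma> ` {1..k} \<noteq> {}"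
    then obtain j where "j \<in> {1..k}" "\<sigma> j \<in> X" by blast
    then have "P j" using that by (auto simp: P_def)
    then show "m \<le> k" using least \<open>j \<in> {1..k}\<close> by fastforce
  next
    assume "m \<le> k"
    then show "X \<inter> \<sigma> ` {1..k} \<noteq> {}" using m by (auto simp: P_def)
  qed
  have "(\<Sum>k=1..CARD('n). reward_gap r \<sigma> k * of_bool (X \<inter> \<sigma> ` {1..k} \<noteq> {})) =
        (\<Sum>k=1..CARD('n). reward_gap r \<sigma> k * of_bool (m \<le> k))"
    by (intro sum.cong refl) (use meets in simp)
  also have "\<dots> = (\<Sum>k=m..CARD('n). reward_gap r \<sigma> k)"
    using m by (intro sum.mono_neutral_cong_right) (auto simp: P_def)
  also have "\<dots> = r $ \<sigma> m"
    using m by (simp add: sum_reward_gap P_def)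
  also have "\<dots> = max_reward r X"
  proof -
    have "r $ i \<le> r $ \<sigma> m" if "i \<in> X" for i
    proof -
      have "i \<in> \<sigma> ` {1..CARD('n)}" using img by simp
      then obtain j where j: "i = \<sigma> j" "j \<in> {1..CARD('n)}" by auto
      then have "P j" using that by (auto simp: P_def)
      then show ?thesis
        using j m least[OF \<open>P j\<close>] by (auto simp: P_def intro!: reward_ordering_antimono[OF ord nonneg])
    qed
    then have "Max ((\<lambda>i. r $ i) ` X) = r $ \<sigma> m"
      using m by (intro Max_eqI) (auto simp: P_def)
    then show ?thesis using False by (simp add: max_reward_def)
  qed
  finally show ?thesis by simp
qed


section \<open>The concave surrogate\<close>

text \<open>A set of weight \<open>w\<close> will be hit with probability between
  \<open>1 - exp (- \<delta> * w)\<close> and \<open>\<delta> * w\<close>. The surrogate takes the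
  lower value where hits help (rewards, negative costs) and the upper value where they hurt
  (positive costs).\<close>

definition mh_surrogate ::
    "real \<Rightarrow> real ^ 'n \<Rightarrow> real ^ 'n \<Rightarrow> (nat \<Rightarrow> 'n) \<Rightarrow> real ^ 'n \<Rightarrow> real" where
  "mh_surrogate \<delta> r c \<sigma> \<omega> =
     (\<Sum>k=1..CARD('n). reward_gap r \<sigma> k * (1 - mh_epsilon \<delta> \<sigma> \<omega> k))
     - (\<Sum>i\<in>UNIV. max 0 (c $ i) * (\<delta> * \<omega> $ i))
     - (\<Sum>i\<in>UNIV. min 0 (c $ i) * (1 - exp (- \<delta> * \<omega> $ i)))"

text \<open>This is \<open>1 + u \<le> exp u\<close>, rescaled to a tangent at
  \<open>x\<close>.\<close>

lemma exp_tangent: "exp (- \<delta> * x) * (1 - \<delta> * (y - x)) \<le> exp (- \<delta> * y)" for x y \<delta> :: real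
proof -
  have "exp (- \<delta> * x) * (1 - \<delta> * (y - x)) \<le> exp (- \<delta> * x) * exp (- \<delta> * (y - x))"
    using exp_ge_add_one_self[of "- \<delta> * (y - x)"] by (intro mult_left_mono) auto
  also have "\<dots> = exp (- \<delta> * y)"
    by (simp add: exp_add[symmetric] algebra_simps)
  finally show ?thesis .
qed

text \<open>A concave function lies below its tangents, and \<open>mh_gradient\<close> is minus the
  gradient of the surrogate. Rewards and negative costs use the tangent of \<open>exp\<close>;
  positive costs enter linearly and contribute exactly.\<close>

lemma mh_surrogate_concave:
  fixes r c \<omega> y :: "real ^ 'n"
  assumes ord: "reward_ordering r \<sigma>" and nonneg: "\<And>i. r $ i \<ge> 0"
  shows "mh_surrogate \<delta> r c \<sigma> y \<le>
         mh_surrogate \<delta> r c \<sigma> \<omega> + mh_gradient \<delta> r c \<sigma> \<omega> \<bullet> (\<omega> - y)"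
proof -
  let ?N = "CARD('n)"
  let ?e = "mh_epsilon \<delta> \<sigma> \<omega>"
  define rank where "rank = the_inv_into {1..?N} \<sigma>"
  have bij: "bij_betw \<sigma> {1..?N} UNIV" using ord by (simp add: reward_ordering_def)
  have rank: "rank (\<sigma> j) = j" if "j \<in> {1..?N}" for j
    unfolding rank_def using bij that by (intro the_inv_into_f_f) (auto simp: bij_betw_def)
  have layer: "reward_gap r \<sigma> k * (1 - mh_epsilon \<delta> \<sigma> y k) \<le>
      reward_gap r \<sigma> k * (1 - ?e k) +
      \<delta> * (\<Sum>j=1..k. reward_gap r \<sigma> k * ?e k * (y - \<omega>) $ \<sigma> j)"
    if k: "k \<in> {1..?N}" for k
  proof -
    have "?e k * (1 - \<delta> * ((\<Sum>j=1..k. y $ \<sigma> j) - (\<Sum>j=1..k. \<omega> $ \<sigma> j))) \<le> mh_epsilon \<delta> \<sigma> y k"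
      unfolding mh_epsilon_def by (rule exp_tangent)
    then have "1 - mh_epsilon \<delta> \<sigma> y k \<le> 1 - ?e k + \<delta> * (?e k * (\<Sum>j=1..k. (y - \<omega>) $ \<sigma> j))"
      by (simp add: sum_subtractf algebra_simps)
    from mult_left_mono[OF this reward_gap_nonneg[OF ord nonneg k]] show ?thesis
      unfolding sum_distrib_left[of "reward_gap r \<sigma> k * ?e k", symmetric]
      by (simp only: distrib_left mult_ac)
  qed
  \<comment> \<open>Layer \<open>k\<close> involves all ranks up to \<open>k\<close>. After
    exchanging the sums, the item of rank \<open>j\<close> collects the layers
    \<open>k \<ge> j\<close>, whose weighted gaps add up to its \<open>mh_lambda\<close>.\<close>
  have swap: "(\<Sum>k=1..?N. \<Sum>j=1..k. reward_gap r \<sigma> k * ?e k * (y - \<omega>) $ \<sigma> j)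
      = (\<Sum>i\<in>UNIV. mh_lambda \<delta> r \<sigma> \<omega> (rank i) * (y - \<omega>) $ i)"
  proof -
    have "(\<Sum>k=1..?N. \<Sum>j=1..k. reward_gap r \<sigma> k * ?e k * (y - \<omega>) $ \<sigma> j)
        = (\<Sum>j=1..?N. \<Sum>k=j..?N. reward_gap r \<sigma> k * ?e k * (y - \<omega>) $ \<sigma> j)"
      unfolding sum.Sigma[OF finite_atLeastAtMost ballI[OF finite_atLeastAtMost]]
      by (rule sum.reindex_bij_witness[of _ "\<lambda>(k, j). (j, k)" "\<lambda>(k, j). (j, k)"]) auto
    also have "\<dots> = (\<Sum>j=1..?N. mh_lambda \<delta> r \<sigma> \<omega> (rank (\<sigma> j)) * (y - \<omega>) $ \<sigma> j)"
      by (intro sum.cong refl) (simp add: rank mh_lambda_eq_sum_gap sum_distrib_right)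
    also have "\<dots> = (\<Sum>i\<in>UNIV. mh_lambda \<delta> r \<sigma> \<omega> (rank i) * (y - \<omega>) $ i)"
      by (rule sum.reindex_bij_betw[OF bij])
    finally show ?thesis .
  qed
  have rewards: "(\<Sum>k=1..?N. reward_gap r \<sigma> k * (1 - mh_epsilon \<delta> \<sigma> y k)) \<le>
      (\<Sum>k=1..?N. reward_gap r \<sigma> k * (1 - ?e k)) +
      \<delta> * (\<Sum>i\<in>UNIV. mh_lambda \<delta> r \<sigma> \<omega> (rank i) * (y - \<omega>) $ i)"
    unfolding swap[symmetric] sum_distrib_left[of \<delta>] sum.distrib[symmetric]
    using layer by (intro sum_mono) (simp add: sum_distrib_left)
  \<comment> \<open>The factor \<open>m\<close> stands for the negative part of a cost, so it
    reverses the tangent inequality.\<close>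
  have "m * (1 - exp (- \<delta> * y $ i)) \<ge>
      m * (1 - exp (- \<delta> * \<omega> $ i)) + \<delta> * (m * exp (- \<delta> * \<omega> $ i) * (y - \<omega>) $ i)"
    if "m \<le> 0" for i m
    using mult_left_mono_neg[OF exp_tangent[of \<delta> "\<omega> $ i" "y $ i"] that]
    by (simp add: algebra_simps)
  then have costs: "(\<Sum>i\<in>UNIV. min 0 (c $ i) * (1 - exp (- \<delta> * y $ i))) \<ge>
      (\<Sum>i\<in>UNIV. min 0 (c $ i) * (1 - exp (- \<delta> * \<omega> $ i))) +
      \<delta> * (\<Sum>i\<in>UNIV. min 0 (c $ i) * exp (- \<delta> * \<omega> $ i) * (y - \<omega>) $ i)"
    unfolding sum_distrib_left[of \<delta>] sum.distrib[symmetric] by (intro sum_mono) simp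
  have "mh_gradient \<delta> r c \<sigma> \<omega> \<bullet> (\<omega> - y) =
      (\<Sum>i\<in>UNIV. max 0 (c $ i) * (\<delta> * \<omega> $ i)) - (\<Sum>i\<in>UNIV. max 0 (c $ i) * (\<delta> * y $ i))
      - \<delta> * (\<Sum>i\<in>UNIV. min 0 (c $ i) * exp (- \<delta> * \<omega> $ i) * (y - \<omega>) $ i)
      + \<delta> * (\<Sum>i\<in>UNIV. mh_lambda \<delta> r \<sigma> \<omega> (rank i) * (y - \<omega>) $ i)"
    unfolding sum_distrib_left[of \<delta>] sum.distrib[symmetric] sum_subtractf[symmetric]
    by (auto simp: inner_vec_def mh_gradient_def rank_def algebra_simps intro!: sum.cong)
  then show ?thesis
    using rewards costs unfolding mh_surrogate_def by linarith
qed

text \<open>At a 0/1 vector the cost terms agree exactly. The inequality comes from the rewards: a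
  prefix met by \<open>S\<close> carries weight at least 1, so its factor is at least
  \<open>1 - exp (- \<delta>)\<close>.\<close>

lemma discounted_profit_le_mh_surrogate:
  fixes r c :: "real ^ 'n"
  assumes ord: "reward_ordering r \<sigma>" and nonneg: "\<And>i. r $ i \<ge> 0" and "\<delta> \<ge> 0"
  shows "discounted_profit (1 - exp (- \<delta>)) \<delta> r c S \<le> mh_surrogate \<delta> r c \<sigma> (\<chi> i. of_bool (i \<in> S))"
proof -
  let ?y = "(\<chi> i. of_bool (i \<in> S)) :: real ^ 'n"
  have layer: "(1 - exp (- \<delta>)) * of_bool (S \<inter> \<sigma> ` {1..k} \<noteq> {}) \<le> 1 - mh_epsilon \<delta> \<sigma> ?y k" for k
  proof (cases "S \<inter> \<sigma> ` {1..k} = {}")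
    case True
    have "(\<Sum>j=1..k. ?y $ \<sigma> j) \<ge> 0" by (intro sum_nonneg) auto
    then show ?thesis using True \<open>\<delta> \<ge> 0\<close> by (simp add: mh_epsilon_def)
  next
    case False
    then obtain l where l: "l \<in> {1..k}" "\<sigma> l \<in> S" by blast
    have "?y $ \<sigma> l \<le> (\<Sum>j=1..k. ?y $ \<sigma> j)"
      using l by (intro member_le_sum) auto
    then have "1 \<le> (\<Sum>j=1..k. ?y $ \<sigma> j)" using l by simp
    then have "\<delta> * 1 \<le> \<delta> * (\<Sum>j=1..k. ?y $ \<sigma> j)" using \<open>\<delta> \<ge> 0\<close> by (rule mult_left_mono)
    then show ?thesis using False by (simp add: mh_epsilon_def)
  qed
  have "(1 - exp (- \<delta>)) * max_reward r S \<le>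
      (\<Sum>k=1..CARD('n). reward_gap r \<sigma> k * (1 - mh_epsilon \<delta> \<sigma> ?y k))"
    unfolding max_reward_layers[OF ord nonneg] sum_distrib_left
  proof (intro sum_mono)
    fix k assume "k \<in> {1..CARD('n)}"
    from mult_left_mono[OF layer reward_gap_nonneg[OF ord nonneg this], of k]
    show "(1 - exp (- \<delta>)) * (reward_gap r \<sigma> k * of_bool (S \<inter> \<sigma> ` {1..k} \<noteq> {}))
        \<le> reward_gap r \<sigma> k * (1 - mh_epsilon \<delta> \<sigma> ?y k)"
      by (simp add: mult_ac)
  qed
  moreover have "(\<Sum>i\<in>UNIV. max 0 (c $ i) * (\<delta> * ?y $ i)) = \<delta> * (\<Sum>i\<in>S. max 0 (c $ i))"
    unfolding sum_distrib_left by (intro sum.mono_neutral_cong_right) auto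
  moreover have "(\<Sum>i\<in>UNIV. min 0 (c $ i) * (1 - exp (- \<delta> * ?y $ i)))
      = (1 - exp (- \<delta>)) * (\<Sum>i\<in>S. min 0 (c $ i))"
    unfolding sum_distrib_left by (intro sum.mono_neutral_cong_right) auto
  ultimately show ?thesis
    unfolding mh_surrogate_def discounted_profit_def by linarith
qed

text \<open>In each component \<open>mh_lambda\<close> lies between 0 and \<open>R\<close>, because
  the factors \<open>mh_epsilon\<close> lie in [0, 1] and the nonnegative gaps telescope to one
  reward. The damped cost lies between \<open>- C\<close> and \<open>C\<close>.\<close>

lemma mh_gradient_norm_le:
  fixes r c \<omega> :: "real ^ 'n"
  assumes ord: "reward_ordering r \<sigma>" and nonneg: "\<And>i. r $ i \<ge> 0" and "\<delta> \<ge> 0"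
    and \<omega>: "\<And>i. \<omega> $ i \<ge> 0" and R: "\<And>i. r $ i \<le> R" and C: "\<And>i. \<bar>c $ i\<bar> \<le> C"
  shows "norm (mh_gradient \<delta> r c \<sigma> \<omega>) \<le> sqrt (real CARD('n)) * (\<delta> * (R + C))"
proof -
  let ?N = "CARD('n)"
  let ?g = "mh_gradient \<delta> r c \<sigma> \<omega>"
  have bound: "\<bar>?g $ i\<bar> \<le> \<delta> * (R + C)" for i
  proof -
    define j where "j = the_inv_into {1..?N} \<sigma> i"
    have "j \<in> {1..?N}"
      unfolding j_def using ord
      by (intro the_inv_into_into[of \<sigma>]) (auto simp: reward_ordering_def bij_betw_def)
    have e: "0 \<le> mh_epsilon \<delta> \<sigma> \<omega> k" "mh_epsilon \<delta> \<sigma> \<omega> k \<le> 1" for k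
      using \<open>\<delta> \<ge> 0\<close> \<omega> by (auto simp: mh_epsilon_def intro!: mult_nonneg_nonneg sum_nonneg)
    have lam: "mh_lambda \<delta> r \<sigma> \<omega> j = (\<Sum>k=j..?N. reward_gap r \<sigma> k * mh_epsilon \<delta> \<sigma> \<omega> k)"
      using \<open>j \<in> _\<close> by (simp add: mh_lambda_eq_sum_gap)
    have gap: "reward_gap r \<sigma> k \<ge> 0" if "k \<in> {j..?N}" for k
      using that \<open>j \<in> _\<close> by (intro reward_gap_nonneg[OF ord nonneg]) auto
    have lam0: "mh_lambda \<delta> r \<sigma> \<omega> j \<ge> 0"
      unfolding lam using e gap by (intro sum_nonneg mult_nonneg_nonneg) auto
    have "mh_lambda \<delta> r \<sigma> \<omega> j \<le> (\<Sum>k=j..?N. reward_gap r \<sigma> k)"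
      unfolding lam using e gap by (intro sum_mono mult_left_le) auto
    also have "\<dots> = r $ \<sigma> j" using \<open>j \<in> _\<close> by (intro sum_reward_gap) auto
    also have "\<dots> \<le> R" by (rule R)
    finally have lamR: "mh_lambda \<delta> r \<sigma> \<omega> j \<le> R" .
    have "0 \<le> exp (- \<delta> * \<omega> $ i)" "exp (- \<delta> * \<omega> $ i) \<le> 1"
      using \<open>\<delta> \<ge> 0\<close> \<omega> by auto
    then have "min 0 (c $ i) * 1 \<le> min 0 (c $ i) * exp (- \<delta> * \<omega> $ i)"
      "min 0 (c $ i) * exp (- \<delta> * \<omega> $ i) \<le> 0"
      by (auto intro: mult_left_mono_neg mult_nonpos_nonneg simp del: mult_1_right mult_le_0_iff)
    moreover have "max 0 (c $ i) + min 0 (c $ i) = c $ i" "0 \<le> max 0 (c $ i)" "max 0 (c $ i) \<le> \<bar>c $ i\<bar>"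
      by auto
    ultimately have "\<bar>max 0 (c $ i) + min 0 (c $ i) * exp (- \<delta> * \<omega> $ i) - mh_lambda \<delta> r \<sigma> \<omega> j\<bar> \<le> R + C"
      using lam0 lamR C[of i] by linarith
    then show ?thesis
      using \<open>\<delta> \<ge> 0\<close> by (simp add: mh_gradient_def j_def abs_mult mult_left_mono)
  qed
  then have nn: "0 \<le> \<delta> * (R + C)" by (meson abs_ge_zero order_trans)
  have "(norm ?g)\<^sup>2 = (\<Sum>i\<in>UNIV. (?g $ i)\<^sup>2)"
    unfolding power2_norm_eq_inner inner_vec_def by (simp add: power2_eq_square)
  also have "\<dots> \<le> (\<Sum>i\<in>(UNIV :: 'n set). (\<delta> * (R + C))\<^sup>2)"
    using bound nn by (intro sum_mono abs_le_square_iff[THEN iffD1]) auto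
  also have "\<dots> = (sqrt (real ?N) * (\<delta> * (R + C)))\<^sup>2"
    by (simp add: power_mult_distrib)
  finally show ?thesis
    using nn by (intro power2_le_imp_le[of "norm ?g"]) auto
qed


section \<open>The selection\<close>

lemma max_size_ge: "z $ i \<le> max_size z"
  unfolding max_size_def by (intro Max_ge) auto

lemma max_size_pos:
  fixes z :: "real ^ 'n"
  assumes "\<And>i. z $ i > 0"
  shows "max_size z > 0"
  using assms[of undefined] max_size_ge[of z undefined] by linarith

lemma mh_tau_bounds:
  fixes z :: "real ^ 'n"
  assumes "\<And>i. z $ i > 0" "max_size z < 1"
  shows "0 < mh_tau z" "mh_tau z < 1"
  using max_size_pos[of z] assms by (auto simp: mh_tau_def real_sqrt_lt_1_iff)

text \<open>For \<open>p < q\<close> the upper end of class \<open>q\<close> is at most the excluded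
  lower end of class \<open>p\<close>, as the powers of \<open>mh_tau z\<close> decrease.\<close>

lemma mh_Omega_unique:
  fixes z :: "real ^ 'n"
  assumes z: "\<And>i. z $ i > 0" "max_size z < 1"
    and "i \<in> mh_Omega z p" "i \<in> mh_Omega z q" "p \<ge> 1" "q \<ge> 1"
  shows "p = q"
proof -
  have "\<not> p < q"
    if p: "i \<in> mh_Omega z p" and q: "i \<in> mh_Omega z q" for p q
  proof
    assume "p < q"
    then have "mh_tau z ^ (q - 1) \<le> mh_tau z ^ p"
      using mh_tau_bounds[OF z] by (intro power_decreasing) auto
    then have "mh_tau z ^ (q - 1) * max_size z \<le> mh_tau z ^ p * max_size z"
      using max_size_pos[OF z(1)] by simp
    then show False using p q by (auto simp: mh_Omega_def)
  qed
  then show ?thesis using assms by (meson linorder_neqE_nat)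
qed

text \<open>The powers of \<open>mh_tau z\<close> tend to 0, so the lower end of a class eventually
  drops below the positive size of \<open>i\<close>; the least such exponent is its class. It is not
  0, because no size exceeds \<open>max_size z\<close>.\<close>

lemma mh_Omega_cover:
  fixes z :: "real ^ 'n"
  assumes z: "\<And>i. z $ i > 0" "max_size z < 1"
  shows "\<exists>q\<in>mh_Gamma z. i \<in> mh_Omega z q"
proof -
  have pos: "max_size z > 0" by (rule max_size_pos[OF z(1)])
  obtain m where "mh_tau z ^ m < z $ i / max_size z"
    using real_arch_pow_inv[of "z $ i / max_size z" "mh_tau z"] mh_tau_bounds[OF z] z pos by auto
  then have ex: "\<exists>m. mh_tau z ^ m * max_size z < z $ i"
    using pos by (auto simp: field_simps)
  define q where "q = (LEAST m. mh_tau z ^ m * max_size z < z $ i)"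
  have q: "mh_tau z ^ q * max_size z < z $ i"
    unfolding q_def using ex by (rule LeastI_ex)
  have "q \<ge> 1"
  proof (rule ccontr)
    assume "\<not> q \<ge> 1"
    then have "q = 0" by simp
    then show False using q max_size_ge[of z i] by simp
  qed
  have "\<not> mh_tau z ^ (q - 1) * max_size z < z $ i"
    using not_less_Least[of "q - 1" "\<lambda>m. mh_tau z ^ m * max_size z < z $ i"] \<open>q \<ge> 1\<close>
    unfolding q_def by simp
  then have "i \<in> mh_Omega z q" using q by (simp add: mh_Omega_def)
  then show ?thesis using \<open>q \<ge> 1\<close> by (auto simp: mh_Gamma_def)
qed

text \<open>Nonempty classes with different numbers are different sets of items, and there are only
  finitely many such sets.\<close>

lemma finite_mh_Gamma:
  fixes z :: "real ^ 'n"
  assumes "\<And>i. z $ i > 0" "max_size z < 1"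
  shows "finite (mh_Gamma z)"
proof (rule inj_on_finite[of "mh_Omega z" _ UNIV])
  show "inj_on (mh_Omega z) (mh_Gamma z)"
    using mh_Omega_unique[OF assms] by (fastforce simp: inj_on_def mh_Gamma_def)
qed auto

section \<open>Draws and hit probabilities\<close>

lemma draw_indices_eq:
  "draw_indices z \<omega> = Sigma (mh_Gamma z) (\<lambda>q. {1..full_draws z \<omega> q + 1})"
  by (auto simp: draw_indices_def)

lemma draw_indices_nonempty:
  fixes z :: "real ^ 'n"
  assumes "\<And>i. z $ i > 0" "max_size z < 1"
  shows "draw_indices z \<omega> \<noteq> {}"
  using mh_Omega_cover[OF assms, of undefined] by (fastforce simp: draw_indices_eq)

text \<open>Only the class of \<open>i\<close> matters. Its full draws and its last draw have total
  mass floor plus fractional part, that is \<open>\<delta>\<close> times the class weight, and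
  \<open>i\<close> receives the share of its weight in the class.\<close>

lemma sum_draw_probability:
  fixes z :: "real ^ 'n"
  assumes z: "\<And>i. z $ i > 0" "max_size z < 1" and \<omega>: "\<And>i. \<omega> $ i \<ge> 0"
  shows "(\<Sum>(q, k)\<in>draw_indices z \<omega>. draw_probability z \<omega> q k (Some i)) = mh_delta z * \<omega> $ i"
proof -
  obtain p where p: "p \<in> mh_Gamma z" "i \<in> mh_Omega z p"
    using mh_Omega_cover[OF z] by blast
  have other: "i \<notin> mh_Omega z q" if "q \<in> mh_Gamma z - {p}" for q
    using that p mh_Omega_unique[OF z, of i p q] by (auto simp: mh_Gamma_def)
  let ?m = "full_draws z \<omega> p" and ?\<pi> = "class_weight z \<omega> p" and ?\<delta> = "mh_delta z"
  have pi0: "?\<pi> \<ge> 0" unfolding class_weight_def by (intro sum_nonneg \<omega>)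
  have m: "real ?m + frac (?\<delta> * ?\<pi>) = ?\<delta> * ?\<pi>"
    using pi0 by (simp add: full_draws_def frac_def mh_delta_def)
  have "\<omega> $ i \<le> ?\<pi>"
    unfolding class_weight_def using p \<omega> by (intro member_le_sum) auto
  \<comment> \<open>Guards the division by zero: a zero class weight forces the weight of
    \<open>i\<close> to vanish, and both sides are 0.\<close>
  then have zero: "\<omega> $ i = 0" if "?\<pi> = 0" using that \<omega>[of i] by linarith
  have "(\<Sum>(q, k)\<in>draw_indices z \<omega>. draw_probability z \<omega> q k (Some i)) =
      (\<Sum>q\<in>mh_Gamma z. \<Sum>k=1..full_draws z \<omega> q + 1. draw_probability z \<omega> q k (Some i))"
    unfolding draw_indices_eq using finite_mh_Gamma[OF z] by (subst sum.Sigma) auto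
  also have "\<dots> = (\<Sum>q\<in>{p}. \<Sum>k=1..full_draws z \<omega> q + 1. draw_probability z \<omega> q k (Some i))"
    using p other finite_mh_Gamma[OF z] by (intro sum.mono_neutral_right) auto
  also have "\<dots> = (\<Sum>k=1..?m. \<omega> $ i / ?\<pi>) + frac (?\<delta> * ?\<pi>) * \<omega> $ i / ?\<pi>"
    using p by simp
  also have "\<dots> = (real ?m + frac (?\<delta> * ?\<pi>)) * \<omega> $ i / ?\<pi>"
    by (simp add: algebra_simps add_divide_distrib)
  also have "\<dots> = ?\<delta> * \<omega> $ i"
    unfolding m using zero by (cases "?\<pi> = 0") auto
  finally show ?thesis .
qed

text \<open>The upper bound is the union bound over the draws. For the lower one, independence makes
  the miss probability a product of factors \<open>1 - s p \<le> exp (- s p)\<close>, and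
  \<open>sum_draw_probability\<close> gives the sum of the \<open>s p\<close>.\<close>

lemma (in prob_space)
  fixes z :: "real ^ 'n"
  assumes z: "\<And>i. z $ i > 0" "max_size z < 1" and \<omega>: "\<And>i. \<omega> $ i \<ge> 0"
    and draws: "selection_draws z \<omega> M \<xi>"
  shows selected_event: "{x \<in> space M. selected_set z \<omega> \<xi> x \<inter> Y \<noteq> {}} \<in> events"
    and prob_selected_le: "prob {x \<in> space M. selected_set z \<omega> \<xi> x \<inter> Y \<noteq> {}} \<le> mh_delta z * (\<Sum>i\<in>Y. \<omega> $ i)"
    and prob_selected_ge:
      "1 - exp (- mh_delta z * (\<Sum>i\<in>Y. \<omega> $ i)) \<le> prob {x \<in> space M. selected_set z \<omega> \<xi> x \<inter> Y \<noteq> {}}"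
proof -
  let ?I = "draw_indices z \<omega>"
  define \<zeta> where "\<zeta> = (\<lambda>(q, k). \<xi> q k)"
  define H where "H p = \<zeta> p -` (Some ` Y) \<inter> space M" for p
  define s where "s p = (\<Sum>i\<in>Y. draw_probability z \<omega> (fst p) (snd p) (Some i))" for p
  have indep: "indep_vars (\<lambda>_. count_space UNIV) \<zeta> ?I"
    using draws by (simp add: selection_draws_def \<zeta>_def)
  have prob: "prob {x \<in> space M. \<zeta> p x = v} = draw_probability z \<omega> (fst p) (snd p) v"
    if "p \<in> ?I" for p v
    using draws that by (auto simp: selection_draws_def \<zeta>_def split: prod.splits)
  have finI: "finite ?I" using finite_mh_Gamma[OF z] by (simp add: draw_indices_eq)
  have meas: "\<zeta> p \<in> M \<rightarrow>\<^sub>M count_space UNIV" if "p \<in> ?I" for p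
    using indep that by (auto simp: indep_vars_def)
  have ev: "\<zeta> p -` A \<inter> space M \<in> events" if "p \<in> ?I" for p A
    using measurable_sets[OF meas[OF that], of A] by simp
  have HE: "H p \<in> events" if "p \<in> ?I" for p unfolding H_def by (rule ev[OF that])
  have probH: "prob (H p) = s p" if p: "p \<in> ?I" for p
  proof -
    have "H p = (\<Union>i\<in>Y. \<zeta> p -` {Some i} \<inter> space M)" by (auto simp: H_def)
    also have "prob \<dots> = (\<Sum>i\<in>Y. prob (\<zeta> p -` {Some i} \<inter> space M))"
      using ev[OF p] by (intro finite_measure_finite_Union) (auto simp: disjoint_family_on_def)
    also have "\<dots> = s p"
      unfolding s_def prob[OF p, symmetric] by (intro sum.cong refl arg_cong[where f = prob]) auto
    finally show ?thesis .
  qed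
  have sum_s: "(\<Sum>p\<in>?I. s p) = mh_delta z * (\<Sum>i\<in>Y. \<omega> $ i)"
    unfolding s_def sum_distrib_left sum_draw_probability[OF z \<omega>, symmetric]
    by (subst sum.swap) (simp add: case_prod_unfold)
  let ?E = "{x \<in> space M. selected_set z \<omega> \<xi> x \<inter> Y \<noteq> {}}"
  have E: "?E = (\<Union>p\<in>?I. H p)"
    by (fastforce simp: selected_set_def H_def \<zeta>_def)
  show "?E \<in> events"
    unfolding E using finI HE by auto
  show "prob ?E \<le> mh_delta z * (\<Sum>i\<in>Y. \<omega> $ i)"
    unfolding E sum_s[symmetric] using finI HE probH
    by (intro order_trans[OF finite_measure_subadditive_finite]) auto
  \<comment> \<open>Missing \<open>Y\<close> means that every draw avoids it. As there is at least
    one draw, the intersection stays within \<open>space M\<close>.\<close>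
  have "prob (space M - ?E) = prob (\<Inter>p\<in>?I. \<zeta> p -` (- Some ` Y) \<inter> space M)"
    unfolding E H_def using draw_indices_nonempty[OF z]
    by (intro arg_cong[where f = prob]) auto
  also have "\<dots> = (\<Prod>p\<in>?I. prob (\<zeta> p -` (- Some ` Y) \<inter> space M))"
    using indep draw_indices_nonempty[OF z] finI by (intro indep_varsD) auto
  also have "\<dots> = (\<Prod>p\<in>?I. prob (space M - H p))"
    by (intro prod.cong refl arg_cong[where f = prob]) (auto simp: H_def)
  also have "\<dots> \<le> (\<Prod>p\<in>?I. exp (- s p))"
  proof (intro prod_mono conjI)
    fix p assume p: "p \<in> ?I"
    show "prob (space M - H p) \<le> exp (- s p)"
      using exp_ge_add_one_self[of "- s p"] probH[OF p] prob_compl[OF HE[OF p]] by simp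
  qed auto
  also have "\<dots> = exp (- mh_delta z * (\<Sum>i\<in>Y. \<omega> $ i))"
    using finI by (simp add: exp_sum[symmetric] sum_negf sum_s)
  finally show "1 - exp (- mh_delta z * (\<Sum>i\<in>Y. \<omega> $ i)) \<le> prob ?E"
    using prob_compl[OF \<open>?E \<in> events\<close>] by simp
qed

text \<open>By the layers of the reward, the profit is linear in indicators of hit events, so only
  hit probabilities matter. The sign of each cost decides which of the two bounds on them
  applies.\<close>

lemma (in prob_space)
  fixes z r c :: "real ^ 'n"
  assumes z: "\<And>i. z $ i > 0" "max_size z < 1" and \<omega>: "\<And>i. \<omega> $ i \<ge> 0"
    and draws: "selection_draws z \<omega> M \<xi>"
    and ord: "reward_ordering r \<sigma>" and nonneg: "\<And>i. r $ i \<ge> 0"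
  shows integrable_profit: "integrable M (\<lambda>x. profit r c (selected_set z \<omega> \<xi> x))"
    and expected_profit_ge:
      "mh_surrogate (mh_delta z) r c \<sigma> \<omega> \<le> expectation (\<lambda>x. profit r c (selected_set z \<omega> \<xi> x))"
proof -
  let ?N = "CARD('n)" and ?\<delta> = "mh_delta z"
  define E where "E Y = {x \<in> space M. selected_set z \<omega> \<xi> x \<inter> Y \<noteq> {}}" for Y
  have [measurable]: "E Y \<in> events" for Y
    unfolding E_def by (rule selected_event[OF z \<omega> draws])
  \<comment> \<open>A finite combination of indicators of events, which gives integrability without
    a measurable structure on sets of items.\<close>
  define f where "f x = (\<Sum>k=1..?N. reward_gap r \<sigma> k * indicat_real (E (\<sigma> ` {1..k})) x)
      - (\<Sum>i\<in>UNIV. c $ i * indicat_real (E {i}) x)" for x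
  have f: "profit r c (selected_set z \<omega> \<xi> x) = f x" if "x \<in> space M" for x
  proof -
    let ?X = "selected_set z \<omega> \<xi> x"
    have ind: "indicat_real (E Y) x = of_bool (?X \<inter> Y \<noteq> {})" for Y
      using that by (simp add: E_def indicator_def)
    have "(\<Sum>i\<in>?X. c $ i) = (\<Sum>i\<in>UNIV. c $ i * indicat_real (E {i}) x)"
      unfolding ind by (intro sum.mono_neutral_cong_left) auto
    then show ?thesis
      unfolding profit_def f_def max_reward_layers[OF ord nonneg] ind by simp
  qed
  have int: "integrable M (\<lambda>x. a * indicat_real (E Y) x)"
    and val: "expectation (\<lambda>x. a * indicat_real (E Y) x) = a * prob (E Y)" for a Y
    by (simp_all add: less_top[symmetric])
  have "integrable M f" unfolding f_def
    by (intro Bochner_Integration.integrable_diff Bochner_Integration.integrable_sum int)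
  then show "integrable M (\<lambda>x. profit r c (selected_set z \<omega> \<xi> x))"
    using f by (simp cong: Bochner_Integration.integrable_cong)
  have exp_f: "expectation f = (\<Sum>k=1..?N. reward_gap r \<sigma> k * prob (E (\<sigma> ` {1..k})))
      - (\<Sum>i\<in>UNIV. c $ i * prob (E {i}))"
    unfolding f_def
    by (simp only: Bochner_Integration.integral_diff Bochner_Integration.integral_sum
        Bochner_Integration.integrable_sum int val)
  have "expectation (\<lambda>x. profit r c (selected_set z \<omega> \<xi> x)) = expectation f"
    by (intro Bochner_Integration.integral_cong refl f)
  moreover have "reward_gap r \<sigma> k * (1 - mh_epsilon ?\<delta> \<sigma> \<omega> k) \<le> reward_gap r \<sigma> k * prob (E (\<sigma> ` {1..k}))"
    if k: "k \<in> {1..?N}" for k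
  proof (intro mult_left_mono reward_gap_nonneg[OF ord nonneg k])
    have "inj_on \<sigma> {1..k}"
      using ord k by (auto simp: reward_ordering_def bij_betw_def elim!: inj_on_subset)
    then have "(\<Sum>i\<in>\<sigma> ` {1..k}. \<omega> $ i) = (\<Sum>j=1..k. \<omega> $ \<sigma> j)"
      by (simp add: sum.reindex)
    then show "1 - mh_epsilon ?\<delta> \<sigma> \<omega> k \<le> prob (E (\<sigma> ` {1..k}))"
      using prob_selected_ge[OF z \<omega> draws, of "\<sigma> ` {1..k}"]
      unfolding E_def mh_epsilon_def by simp
  qed
  then have "(\<Sum>k=1..?N. reward_gap r \<sigma> k * (1 - mh_epsilon ?\<delta> \<sigma> \<omega> k)) \<le>
      (\<Sum>k=1..?N. reward_gap r \<sigma> k * prob (E (\<sigma> ` {1..k})))"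
    by (rule sum_mono)
  moreover have "(\<Sum>i\<in>UNIV. c $ i * prob (E {i})) \<le> (\<Sum>i\<in>UNIV. max 0 (c $ i) * (?\<delta> * \<omega> $ i))
      + (\<Sum>i\<in>UNIV. min 0 (c $ i) * (1 - exp (- ?\<delta> * \<omega> $ i)))"
    unfolding sum.distrib[symmetric]
  proof (intro sum_mono)
    fix i
    have "prob (E {i}) \<le> ?\<delta> * \<omega> $ i" "1 - exp (- ?\<delta> * \<omega> $ i) \<le> prob (E {i})"
      using prob_selected_le[OF z \<omega> draws, of "{i}"] prob_selected_ge[OF z \<omega> draws, of "{i}"]
      by (auto simp: E_def)
    then have "max 0 (c $ i) * prob (E {i}) \<le> max 0 (c $ i) * (?\<delta> * \<omega> $ i)"
      and "min 0 (c $ i) * prob (E {i}) \<le> min 0 (c $ i) * (1 - exp (- ?\<delta> * \<omega> $ i))"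
      by (blast intro: mult_left_mono mult_left_mono_neg max.cobounded1 min.cobounded1)+
    moreover have "c $ i * prob (E {i}) = max 0 (c $ i) * prob (E {i}) + min 0 (c $ i) * prob (E {i})"
      by (auto simp: max_def min_def)
    ultimately show "c $ i * prob (E {i}) \<le>
        max 0 (c $ i) * (?\<delta> * \<omega> $ i) + min 0 (c $ i) * (1 - exp (- ?\<delta> * \<omega> $ i))"
      by linarith
  qed
  ultimately show "mh_surrogate ?\<delta> r c \<sigma> \<omega> \<le> expectation (\<lambda>x. profit r c (selected_set z \<omega> \<xi> x))"
    unfolding mh_surrogate_def exp_f by linarith
qed


section \<open>Projected gradient descent\<close>

text \<open>These make the projection onto the polytope well defined; convexity and closedness come
  from writing it as an intersection of closed halfspaces.\<close>

lemma
  fixes z :: "real ^ 'n"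
  shows zero_in_weight_polytope: "0 \<in> weight_polytope z"
    and convex_weight_polytope: "convex (weight_polytope z)"
    and closed_weight_polytope: "closed (weight_polytope z)"
proof -
  have eq: "weight_polytope z =
      (\<Inter>i. {x. axis i 1 \<bullet> x \<ge> 0} \<inter> {x. axis i 1 \<bullet> x \<le> 1}) \<inter> {x. z \<bullet> x \<le> 1}"
    by (auto simp: weight_polytope_def inner_axis' inner_commute[of _ z])
  show "0 \<in> weight_polytope z" by (simp add: weight_polytope_def)
  show "convex (weight_polytope z)"
    unfolding eq by (intro convex_Int convex_INT convex_halfspace_ge convex_halfspace_le)
  show "closed (weight_polytope z)"
    unfolding eq by (intro closed_Int closed_INT ballI closed_halfspace_ge closed_halfspace_le)
qed

lemma weight_polytope_diameter:
  fixes x y z :: "real ^ 'n"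
  assumes "x \<in> weight_polytope z" "y \<in> weight_polytope z"
  shows "(norm (x - y))\<^sup>2 \<le> real CARD('n)"
proof -
  have "(norm (x - y))\<^sup>2 = (\<Sum>i\<in>UNIV. (x $ i - y $ i)\<^sup>2)"
    unfolding power2_norm_eq_inner inner_vec_def by (simp add: power2_eq_square)
  also have "\<dots> \<le> (\<Sum>i\<in>(UNIV :: 'n set). 1)"
  proof (intro sum_mono)
    fix i
    have "0 \<le> x $ i" "x $ i \<le> 1" "0 \<le> y $ i" "y $ i \<le> 1"
      using assms by (auto simp: weight_polytope_def)
    then have "\<bar>x $ i - y $ i\<bar> \<le> 1" by linarith
    then show "(x $ i - y $ i)\<^sup>2 \<le> 1" by (simp add: abs_square_le_1)
  qed
  finally show ?thesis by simp
qed

text \<open>Projection is nonexpansive and fixes \<open>y\<close>, so the projected point is at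
  least as close to \<open>y\<close> as the unprojected one. Expand that square and solve for the
  inner product.\<close>

lemma projected_step:
  fixes \<omega> y g :: "'a :: euclidean_space"
  assumes "convex C" "closed C" "y \<in> C" "\<eta> > 0"
  shows "g \<bullet> (\<omega> - y) \<le>
    ((norm (\<omega> - y))\<^sup>2 - (norm (closest_point C (\<omega> - \<eta> *\<^sub>R g) - y))\<^sup>2) / (2 * \<eta>) + \<eta> * (norm g)\<^sup>2 / 2"
proof -
  have "norm (closest_point C (\<omega> - \<eta> *\<^sub>R g) - y) \<le> norm (\<omega> - \<eta> *\<^sub>R g - y)"
    using closest_point_lipschitz[of C "\<omega> - \<eta> *\<^sub>R g" y] assms closest_point_self[of y C]
    by (auto simp: dist_norm)
  then have "(norm (closest_point C (\<omega> - \<eta> *\<^sub>R g) - y))\<^sup>2 \<le> (norm (\<omega> - \<eta> *\<^sub>R g - y))\<^sup>2"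
    by (intro power_mono) auto
  also have "\<dots> = (norm (\<omega> - y))\<^sup>2 - 2 * \<eta> * (g \<bullet> (\<omega> - y)) + \<eta>\<^sup>2 * (norm g)\<^sup>2"
    unfolding power2_norm_eq_inner by (simp add: algebra_simps inner_commute power2_eq_square)
  finally show ?thesis
    using \<open>\<eta> > 0\<close> by (simp add: field_simps power2_eq_square)
qed

text \<open>
  \<open>G t\<close> bounds the first \<open>t\<close> gradients. If \<open>G (Suc t) = 0\<close> then the step size is the junk value
  \<open>D / 0 = 0\<close>, which is harmless because \<open>g t = 0\<close>. The term with
  \<open>(norm (w T - y))\<^sup>2\<close> is kept because the sum with increasing inverse step sizes
  only telescopes in its presence.
\<close>

lemma projected_descent_regret:
  fixes w g :: "nat \<Rightarrow> 'a :: euclidean_space" and G :: "nat \<Rightarrow> real"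
  assumes C: "convex C" "closed C" "y \<in> C" and w0: "\<And>t. t \<le> T \<Longrightarrow> (norm (w t - y))\<^sup>2 \<le> D\<^sup>2" and "D > 0"
    and mono: "\<And>t. G t \<le> G (Suc t)" and G: "\<And>t. norm (g t) \<le> G (Suc t)"
    and step: "\<And>t. w (Suc t) = closest_point C (w t - (D / G (Suc t) / sqrt (2 * real (Suc t))) *\<^sub>R g t)"
  shows "(\<Sum>t<T. g t \<bullet> (w t - y)) \<le>
    G T * sqrt (2 * real T) / (2 * D) * (D\<^sup>2 - (norm (w T - y))\<^sup>2) + D * G T * sqrt (2 * real T) / 2"
  using w0
proof (induction T)
  case 0
  then show ?case by simp
next
  case (Suc T)
  let ?s = "sqrt (2 * real (Suc T))" and ?s' = "sqrt (2 * real T)" and ?G = "G (Suc T)"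
  let ?d = "(norm (w T - y))\<^sup>2" and ?d' = "(norm (w (Suc T) - y))\<^sup>2"
  have s: "?s > 0" by simp
  have G0: "?G \<ge> 0" using G[of T] norm_ge_zero order_trans by blast
  have one: "g T \<bullet> (w T - y) \<le> ?G * ?s / (2 * D) * (?d - ?d') + D * ?G / (2 * ?s)"
  proof (cases "?G = 0")
    case True
    then show ?thesis using G[of T] by simp
  next
    case False
    then have "?G > 0" using G0 by simp
    define \<eta> where "\<eta> = D / ?G / ?s"
    have "\<eta> > 0" using \<open>?G > 0\<close> \<open>D > 0\<close> s by (simp add: \<eta>_def)
    have "g T \<bullet> (w T - y) \<le> (?d - ?d') / (2 * \<eta>) + \<eta> * (norm (g T))\<^sup>2 / 2"
      unfolding step \<eta>_def[symmetric] by (rule projected_step[OF C \<open>\<eta> > 0\<close>])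
    also have "\<eta> * (norm (g T))\<^sup>2 / 2 \<le> \<eta> * ?G\<^sup>2 / 2"
      using \<open>\<eta> > 0\<close> G[of T] by (intro divide_right_mono mult_left_mono power_mono) auto
    also have "\<eta> * ?G\<^sup>2 / 2 = D * ?G / (2 * ?s)"
      using \<open>?G > 0\<close> s by (simp add: \<eta>_def power2_eq_square)
    also have "(?d - ?d') / (2 * \<eta>) = ?G * ?s / (2 * D) * (?d - ?d')"
      by (simp add: \<eta>_def)
    finally show ?thesis by simp
  qed
  \<comment> \<open>Up to the factor \<open>D\<close> these are inverse step sizes. Since
    \<open>D\<^sup>2 - ?d\<close> is nonnegative, the coefficient inherited from earlier trials may
    be raised to the current one, after which the \<open>?d\<close> terms cancel.\<close>
  have GT: "G T * ?s' \<le> ?G * ?s"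
    using mono[of T] G0 by (intro mult_mono) auto
  have "(\<Sum>t<T. g t \<bullet> (w t - y)) \<le> G T * ?s' / (2 * D) * (D\<^sup>2 - ?d) + D * G T * ?s' / 2"
    using Suc by simp
  also have "\<dots> \<le> ?G * ?s / (2 * D) * (D\<^sup>2 - ?d) + D * ?G * ?s' / 2"
    using GT mono[of T] Suc.prems[of T] \<open>D > 0\<close>
    by (intro add_mono mult_right_mono divide_right_mono mult_left_mono) auto
  finally have "(\<Sum>t<Suc T. g t \<bullet> (w t - y)) \<le>
      (?G * ?s / (2 * D) * (D\<^sup>2 - ?d) + D * ?G * ?s' / 2) +
      (?G * ?s / (2 * D) * (?d - ?d') + D * ?G / (2 * ?s))"
    using one unfolding sum.lessThan_Suc by (rule add_mono)
  also have "\<dots> = ?G * ?s / (2 * D) * (D\<^sup>2 - ?d') + D * ?G * (?s' / 2 + 1 / (2 * ?s))"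
    by (simp add: right_diff_distrib distrib_left)
  finally have "(\<Sum>t<Suc T. g t \<bullet> (w t - y)) \<le>
      ?G * ?s / (2 * D) * (D\<^sup>2 - ?d') + D * ?G * (?s' / 2 + 1 / (2 * ?s))" .
  \<comment> \<open>Here \<open>?s\<^sup>2 + ?s'\<^sup>2 = 4 * T + 2\<close>, so
    \<open>?s * ?s' + 1\<close> is at most \<open>2 * T + 2\<close>, which is
    \<open>?s\<^sup>2\<close>; divide by \<open>2 * ?s\<close>.\<close>
  moreover have "?s' / 2 + 1 / (2 * ?s) \<le> ?s / 2"
  proof -
    have "2 * (?s * ?s') \<le> ?s\<^sup>2 + ?s'\<^sup>2"
      using sum_squares_bound[of ?s ?s'] by (simp add: mult.assoc)
    then have "?s * ?s' + 1 \<le> ?s * ?s" by simp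
    then show ?thesis using s by (simp add: field_simps)
  qed
  then have "D * ?G * (?s' / 2 + 1 / (2 * ?s)) \<le> D * ?G * (?s / 2)"
    using G0 \<open>D > 0\<close> by (intro mult_left_mono) auto
  ultimately show ?case by simp
qed

section \<open>Regret of the MaxHedge weights\<close>

lemma mh_state_in_weight_polytope: "fst (mh_state z r c \<sigma> t) \<in> weight_polytope z"
proof (cases t)
  case 0
  then show ?thesis by (simp add: zero_in_weight_polytope)
next
  case (Suc s)
  have "weight_polytope z \<noteq> {}" using zero_in_weight_polytope by blast
  then show ?thesis
    unfolding Suc by (simp add: Let_def closest_point_in_set[OF closed_weight_polytope])
qed

text \<open>Capping the rate by each quotient in turn amounts to dividing
  \<open>sqrt (real CARD('n))\<close> by the running maximum of the gradient norms. This is the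
  setting of \<open>projected_descent_regret\<close>, with that square root as
  \<open>D\<close>.\<close>

lemma mh_regret:
  fixes z y :: "real ^ 'n" and r c :: "nat \<Rightarrow> real ^ 'n" and \<sigma> :: "nat \<Rightarrow> nat \<Rightarrow> 'n"
  defines "w \<equiv> \<lambda>t. fst (mh_state z r c \<sigma> t)"
    and "g \<equiv> \<lambda>t. mh_gradient (mh_delta z) (r (Suc t)) (c (Suc t)) (\<sigma> (Suc t)) (fst (mh_state z r c \<sigma> t))"
  assumes y: "y \<in> weight_polytope z" and B: "\<And>t. t < T \<Longrightarrow> norm (g t) \<le> B" and "B \<ge> 0"
  shows "(\<Sum>t<T. g t \<bullet> (w t - y)) \<le> sqrt (real CARD('n)) * B * sqrt (2 * real T)"
proof -
  let ?C = "weight_polytope z"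
  let ?D = "sqrt (real CARD('n))"
  have D: "?D > 0" by simp
  \<comment> \<open>The real \<open>?D / G t\<close> agrees with the extended-real learning rate even while \<open>G t = 0\<close>:
    there \<open>real_of_ereal \<infinity> = 0\<close> matches \<open>?D / 0 = 0\<close>.\<close>
  define G where "G t = Max (insert 0 ((\<lambda>s. norm (g s)) ` {..<t}))" for t
  have G0: "G t \<ge> 0" for t unfolding G_def by (rule Max_ge) auto
  have GS: "G (Suc t) = max (norm (g t)) (G t)" for t
  proof -
    have "insert 0 ((\<lambda>s. norm (g s)) ` {..<Suc t}) = insert (norm (g t)) (insert 0 ((\<lambda>s. norm (g s)) ` {..<t}))"
      by (auto simp: lessThan_Suc)
    then show ?thesis unfolding G_def by (metis Max_insert finite.insertI finite_imageI finite_lessThan insert_not_empty)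
  qed
  \<comment> \<open>In \<open>ereal\<close> a positive number divided by 0 is \<infinity>, so the
    quotient is antitone on all nonnegative divisors, 0 included.\<close>
  have quot: "min (ereal ?D / ereal a) (ereal ?D / ereal b) = ereal ?D / ereal (max b a)"
    if "a \<ge> 0" "b \<ge> 0" for a b
  proof -
    have "ereal ?D / ereal v \<le> ereal ?D / ereal u" if "0 \<le> u" "u \<le> v" for u v
      using that D by (cases "u = 0") (auto intro!: divide_left_mono)
    from this[of a b] this[of b a] show ?thesis
      using that by (cases "a \<le> b") (auto simp only: max.absorb1 max.absorb2 min.absorb1 min.absorb2 linear)
  qed
  have eta: "snd (mh_state z r c \<sigma> t) = ereal ?D / ereal (G t)" for t
  proof (induction t)
    case 0
    then show ?case using D by (simp add: G_def)
  next
    case (Suc t)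
    then show ?case
      using quot[OF G0[of t], of "norm (g t)"] by (simp add: Let_def GS g_def)
  qed
  have real: "real_of_ereal (ereal ?D / ereal a / ereal b) = ?D / a / b" if "a \<ge> 0" "b > 0" for a b
    using that D by (cases "a = 0") auto
  have step: "w (Suc t) = closest_point ?C (w t - (?D / G (Suc t) / sqrt (2 * real (Suc t))) *\<^sub>R g t)" for t
  proof -
    have "w (Suc t) = closest_point ?C (w t -
        real_of_ereal (snd (mh_state z r c \<sigma> (Suc t)) / ereal (sqrt (2 * real (Suc t)))) *\<^sub>R g t)"
      by (simp add: w_def g_def Let_def)
    then show ?thesis
      unfolding eta by (subst (asm) real[OF G0]) auto
  qed
  have C: "convex ?C" "closed ?C"
    by (rule convex_weight_polytope, rule closed_weight_polytope)
  have inC: "w t \<in> ?C" for t unfolding w_def by (rule mh_state_in_weight_polytope)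
  have GB: "G T \<le> B" unfolding G_def using B \<open>B \<ge> 0\<close> by auto
  have "(\<Sum>t<T. g t \<bullet> (w t - y)) \<le>
    G T * sqrt (2 * real T) / (2 * ?D) * (?D\<^sup>2 - (norm (w T - y))\<^sup>2) + ?D * G T * sqrt (2 * real T) / 2"
    using weight_polytope_diameter[OF inC y]
    by (intro projected_descent_regret[OF C(1,2) y _ D _ _ step]) (auto simp: GS)
  \<comment> \<open>Dropping the final distance leaves two equal halves, because
    \<open>?D\<^sup>2 / (2 * ?D) = ?D / 2\<close>.\<close>
  also have "\<dots> \<le> G T * sqrt (2 * real T) / (2 * ?D) * ?D\<^sup>2 + ?D * G T * sqrt (2 * real T) / 2"
    using G0[of T] by (intro add_mono mult_left_mono) auto
  also have "\<dots> = ?D * G T * sqrt (2 * real T)"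
  proof -
    have "a / (2 * d) * d\<^sup>2 + d * a / 2 = d * a" if "d > 0" for a d :: real
      using that by (simp add: field_simps power2_eq_square)
    from this[OF D, of "G T * sqrt (2 * real T)"] show ?thesis by (simp only: mult.assoc)
  qed
  also have "\<dots> \<le> ?D * B * sqrt (2 * real T)"
    using GB by (intro mult_right_mono mult_left_mono) auto
  finally show "(\<Sum>t<T. g t \<bullet> (w t - y)) \<le> ?D * B * sqrt (2 * real T)" .
qed

section \<open>Summing the bounds of the single trials\<close>

theorem theorem5p20:
  fixes T :: nat
    and z :: "real ^ 'n"
    and c r :: "nat \<Rightarrow> real ^ 'n"
    and \<sigma> :: "nat \<Rightarrow> nat \<Rightarrow> 'n"
    and M :: "'a measure"
    and \<xi> :: "nat \<Rightarrow> nat \<Rightarrow> nat \<Rightarrow> 'a \<Rightarrow> 'n option"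
    and \<omega> :: "nat \<Rightarrow> real ^ 'n"
    and X :: "nat \<Rightarrow> 'a \<Rightarrow> 'n set"
    and rhat chat :: real
    and S :: "'n set"
  defines "\<omega> \<equiv> mh_weights z r c \<sigma>"
    and "X \<equiv> (\<lambda>t. selected_set z (\<omega> t) (\<xi> t))"
    and "rhat \<equiv> Max ((\<lambda>(t, i). r t $ i) ` ({1..T} \<times> UNIV))"
    and "chat \<equiv> Max ((\<lambda>(t, i). \<bar>c t $ i\<bar>) ` ({1..T} \<times> UNIV))"
  assumes "T \<ge> 1"
    and "\<And>i. z $ i > 0"
    and "max_size z < 1"
    and "\<And>t i. t \<in> {1..T} \<Longrightarrow> r t $ i \<ge> 0"
    and "\<And>t. t \<in> {1..T} \<Longrightarrow> reward_ordering (r t) (\<sigma> t)"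
    and "prob_space M"
    and "\<And>t. t \<in> {1..T} \<Longrightarrow> selection_draws z (\<omega> t) M (\<xi> t)"
    and "(\<Sum>i\<in>S. z $ i) \<le> 1"
  shows "(\<integral>x. (\<Sum>t=1..T. profit (r t) (c t) (X t x)) \<partial>M) \<ge>
           (\<Sum>t=1..T. discounted_profit (mh_alpha z) (mh_delta z) (r t) (c t) S)
           - real CARD('n) * sqrt (2 * real T) * mh_delta z * (rhat + chat)"
proof -
  interpret prob_space M by fact
  let ?\<delta> = "mh_delta z"
  define y :: "real ^ 'n" where "y = (\<chi> i. of_bool (i \<in> S))"
  define g where "g t = mh_gradient ?\<delta> (r (Suc t)) (c (Suc t)) (\<sigma> (Suc t)) (fst (mh_state z r c \<sigma> t))" for t
  define B where "B = sqrt (real CARD('n)) * (?\<delta> * (rhat + chat))"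
  have \<delta>: "?\<delta> \<ge> 0" by (simp add: mh_delta_def)
  have inC: "\<omega> t \<in> weight_polytope z" for t
    unfolding \<omega>_def mh_weights_def
    by (rule mh_state_in_weight_polytope)
  then have \<omega>: "\<omega> t $ i \<ge> 0" for t i by (auto simp: weight_polytope_def)
  have r: "r t $ i \<le> rhat" and c: "\<bar>c t $ i\<bar> \<le> chat" if "t \<in> {1..T}" for t i
    unfolding rhat_def chat_def using that by (auto intro!: Max_ge rev_image_eqI[of "(t, i)"])
  have "0 \<le> rhat" "0 \<le> chat"
    using r[of 1 undefined] c[of 1 undefined] assms(8)[of 1 undefined] \<open>T \<ge> 1\<close> by auto
  \<comment> \<open>The size constraint on \<open>S\<close> makes its indicator vector a feasible
    comparator.\<close>
  have y: "y \<in> weight_polytope z"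
  proof -
    have "y \<bullet> z = (\<Sum>i\<in>S. z $ i)"
      unfolding inner_vec_def y_def by (intro sum.mono_neutral_cong_right) auto
    then show ?thesis using assms(12) by (simp add: weight_polytope_def y_def)
  qed
  \<comment> \<open>The gradients are numbered by the state they are computed from, so trial
    \<open>t\<close> has gradient \<open>g (t - 1)\<close>.\<close>
  have trial: "discounted_profit (mh_alpha z) ?\<delta> (r t) (c t) S - g (t - 1) \<bullet> (\<omega> t - y)
      \<le> expectation (\<lambda>x. profit (r t) (c t) (X t x))" if t: "t \<in> {1..T}" for t
  proof -
    note ord = assms(9)[OF t] and nonneg = assms(8)[OF t]
    have "discounted_profit (mh_alpha z) ?\<delta> (r t) (c t) S \<le> mh_surrogate ?\<delta> (r t) (c t) (\<sigma> t) y"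
      using discounted_profit_le_mh_surrogate[OF ord nonneg \<delta>]
      by (simp add: y_def mh_alpha_def mh_delta_def)
    also have "\<dots> \<le> mh_surrogate ?\<delta> (r t) (c t) (\<sigma> t) (\<omega> t) + g (t - 1) \<bullet> (\<omega> t - y)"
      using mh_surrogate_concave[OF ord nonneg] t by (simp add: g_def \<omega>_def mh_weights_def)
    also have "mh_surrogate ?\<delta> (r t) (c t) (\<sigma> t) (\<omega> t) \<le> expectation (\<lambda>x. profit (r t) (c t) (X t x))"
      unfolding X_def by (rule expected_profit_ge[OF assms(6,7) \<omega> assms(11)[OF t] ord nonneg])
    finally show ?thesis by simp
  qed
  have bound: "norm (g t) \<le> B" if "t < T" for t
  proof -
    have t: "Suc t \<in> {1..T}" using that by simp
    have "\<And>i. fst (mh_state z r c \<sigma> t) $ i \<ge> 0"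
      using \<omega>[of "Suc t"] by (simp add: \<omega>_def mh_weights_def)
    then show ?thesis
      unfolding g_def B_def
      by (intro mh_gradient_norm_le assms(9)[OF t] assms(8)[OF t] \<delta> r[OF t] c[OF t])
  qed
  have "B \<ge> 0" unfolding B_def using \<delta> \<open>0 \<le> rhat\<close> \<open>0 \<le> chat\<close> by simp
  have "(\<Sum>t=1..T. g (t - 1) \<bullet> (\<omega> t - y)) = (\<Sum>t<T. g t \<bullet> (fst (mh_state z r c \<sigma> t) - y))"
    by (rule sum.reindex_bij_witness[of _ Suc "\<lambda>t. t - 1"]) (auto simp: \<omega>_def mh_weights_def)
  also have "\<dots> \<le> sqrt (real CARD('n)) * B * sqrt (2 * real T)"
    using mh_regret[OF y, of T r c \<sigma> B] bound \<open>B \<ge> 0\<close> by (simp add: g_def)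
  \<comment> \<open>The factor \<open>real CARD('n)\<close> joins two square roots, one from the
    diameter of the polytope and one from the gradient norm.\<close>
  also have "\<dots> = real CARD('n) * sqrt (2 * real T) * ?\<delta> * (rhat + chat)"
    by (simp add: B_def)
  finally have regret: "(\<Sum>t=1..T. g (t - 1) \<bullet> (\<omega> t - y)) \<le>
      real CARD('n) * sqrt (2 * real T) * ?\<delta> * (rhat + chat)" .
  \<comment> \<open>The weights are deterministic and only the draws are random, so linearity of
    expectation lets each trial be bounded separately.\<close>
  have "(\<integral>x. (\<Sum>t=1..T. profit (r t) (c t) (X t x)) \<partial>M) =
      (\<Sum>t=1..T. expectation (\<lambda>x. profit (r t) (c t) (X t x)))"
    unfolding X_def
    by (intro Bochner_Integration.integral_sum integrable_profit[OF assms(6,7) \<omega> assms(11) assms(9,8)])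
  also have "\<dots> \<ge> (\<Sum>t=1..T. discounted_profit (mh_alpha z) ?\<delta> (r t) (c t) S - g (t - 1) \<bullet> (\<omega> t - y))"
    by (intro sum_mono trial)
  finally show ?thesis
    using regret by (simp add: sum_subtractf)
qed

end
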